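(* Let $p>3$ be a prime and let $a,b$ be rationals with denominators not divisible by $p$ such that $p\nmid ab$. Then $$\sum_{k=0}^{[p/3]}\binom{3k}k\frac{b^{2k}}{a^k}\equiv\begin{cases}(-3a)^{[p/3]+1}\,U_{\frac{p-(\frac p3)}3-1}(9b,3a)\pmod p&\text{if }\big(\frac{81b^2-12a}p\big)=1,\\ -(-3a)^{[p/3]}\,U_{\frac{p-(\frac p3)}3+1}(9b,3a)\pmod p&\text{if }\big(\frac{81b^2-12a}p\big)=-1.\end{cases}$$
   Context: $[x]$ is the greatest integer not exceeding $x$. The Lucas sequence $U_n(P,Q)$ is defined by $U_0=0$, $U_1=1$, $U_{n+1}=PU_n-QU_{n-1}$ for $n\ge1$. $\big(\frac p3\big)$ is the Legendre symbol ($=1$ if $p\equiv1\pmod3$, $-1$ if $p\equiv2\pmod 3$); for a rational $r$ with denominator prime to $p$, $\big(\frac rp\big)$ is the Legendre symbol of its residue mod $p$. Congruences are in the ring of rationals with denominator prime to $p$. *)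

theory Defs
  imports Complex_Main "HOL-Number_Theory.Number_Theory"
begin

definition p_integers :: "nat \<Rightarrow> rat set" where
  "p_integers p = {r. \<not> int p dvd snd (quotient_of r)}"

definition rat_cong :: "nat \<Rightarrow> rat \<Rightarrow> rat \<Rightarrow> bool" where
  "rat_cong p x y \<longleftrightarrow> x \<in> p_integers p \<and> y \<in> p_integers p \<and>
     (\<exists>z \<in> p_integers p. x - y = of_nat p * z)"

text \<open>The residue is the representative in $[0,p)$; it is uniquely determined when
  \<open>p\<close> is prime and \<open>r \<in> p_integers p\<close>, and unspecified otherwise.\<close>

definition rat_residue :: "nat \<Rightarrow> rat \<Rightarrow> int" where
  "rat_residue p r = (THE n. 0 \<le> n \<and> n < int p \<and> rat_cong p r (of_int n))"

definition rat_Legendre :: "rat \<Rightarrow> nat \<Rightarrow> int" where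
  "rat_Legendre r p = Legendre (rat_residue p r) (int p)"

fun lucas_U :: "nat \<Rightarrow> 'a::comm_ring_1 \<Rightarrow> 'a \<Rightarrow> 'a" where
  "lucas_U 0 P Q = 0"
| "lucas_U (Suc 0) P Q = 1"
| "lucas_U (Suc (Suc n)) P Q = P * lucas_U (Suc n) P Q - Q * lucas_U n P Q"

end

theory Submission
  imports Defs
begin

text \<open>Every \<open>p\<close>-integral rational is congruent to an integer modulo \<open>p\<close>, so \<open>a\<close>, \<open>b\<close> and \<open>x = b\<^sup>2/a\<close>
  may be taken to be integers. Put \<open>n = p div 3\<close>. Since \<open>p\<close> divides \<open>(3n + 1)(3n + 2)\<close>, one has
  \<open>(3k choose k) \<equiv> (n+k choose 2k) (-27)^k\<close> for \<open>k \<le> n\<close>. As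
  \<open>U_{2n+1}(P,Q) = \<Sum>k\<le>n. (n+k choose 2k) P^{2k} (-Q)^{n-k}\<close>, the sum times \<open>(-3a)^n\<close> is
  congruent to \<open>U_{2n+1}(9b,3a)\<close>.

  Let \<open>D = P^2 - 4Q\<close> and \<open>\<epsilon> = (D/p)\<close>. The sequence \<open>U(2P,4Q)\<close> is the binomial transform of
  \<open>U(0,-D)\<close>, and only the extreme terms of a binomial transform survive modulo \<open>p\<close> at index \<open>p\<close>.
  With Euler's criterion this gives \<open>U_p \<equiv> \<epsilon>\<close> and \<open>2 U_{p+1} \<equiv> P (1 + \<epsilon>)\<close>, hence
  \<open>U_{p-\<epsilon>} \<equiv> 0\<close>, and d'Ocagne's identity reflects the index \<open>2n+1\<close> to \<open>p - \<epsilon> - (2n+1)\<close>.\<close>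

section \<open>Lucas sequences\<close>

lemma of_int_lucas_U: "of_int (lucas_U n P Q) = lucas_U n (of_int P) (of_int Q)"
  by (induction n P Q rule: lucas_U.induct) simp_all

lemma lucas_U_scale: "lucas_U (Suc n) (c * P) (c\<^sup>2 * Q) = c ^ n * lucas_U (Suc n) P Q"
proof (induction n rule: induct_nat_012)
  case (ge2 n)
  then show ?case by (simp add: algebra_simps power2_eq_square)
qed simp_all

lemma lucas_U_0_left: "lucas_U n 0 (- D) = (if odd n then D ^ (n div 2) else 0)"
  by (induction n rule: induct_nat_012) auto

lemma lucas_U_d_Ocagne:
  fixes P Q :: "'a::comm_ring_1"
  shows "Q ^ m * lucas_U j P Q =
    lucas_U (m + j) P Q * lucas_U (Suc m) P Q - lucas_U (Suc (m + j)) P Q * lucas_U m P Q"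
proof (induction m)
  case (Suc m)
  have "Q ^ Suc m * lucas_U j P Q =
      Q * (lucas_U (m + j) P Q * lucas_U (Suc m) P Q - lucas_U (Suc (m + j)) P Q * lucas_U m P Q)"
    using Suc.IH by (simp add: mult.assoc)
  then show ?case by (simp add: algebra_simps)
qed simp

lemma lucas_U_Suc_eq_sum_binomial:
  fixes P Q :: "'a::comm_ring_1"
  shows "lucas_U (Suc n) P Q = (\<Sum>j\<le>n. of_nat ((n - j) choose j) * P ^ (n - 2 * j) * (- Q) ^ j)"
proof (induction n rule: induct_nat_012)
  case (ge2 n)
  let ?t = "\<lambda>n j. of_nat ((n - j) choose j) * P ^ (n - 2 * j) * (- Q) ^ j"
  have recurrence: "?t (Suc (Suc n)) (Suc j) = P * ?t (Suc n) (Suc j) - Q * ?t n j" if "j \<le> n" for j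
  proof (cases "2 * j < n")
    case True
    then have "n - 2 * j = Suc (n - Suc (2 * j))" by simp
    with that show ?thesis by (simp add: Suc_diff_le algebra_simps)
  next
    case False
    with that show ?thesis by (simp add: Suc_diff_le binomial_eq_0 algebra_simps)
  qed
  have "(\<Sum>j\<le>Suc (Suc n). ?t (Suc (Suc n)) j) = (\<Sum>j\<le>Suc n. ?t (Suc (Suc n)) j)"
    by simp
  also have "\<dots> = P * ?t (Suc n) 0 + (\<Sum>j\<le>n. P * ?t (Suc n) (Suc j) - Q * ?t n j)"
    unfolding sum.atMost_Suc_shift by (intro arg_cong2[where f = "(+)"] sum.cong recurrence) auto
  also have "\<dots> = P * (\<Sum>j\<le>Suc n. ?t (Suc n) j) - Q * (\<Sum>j\<le>n. ?t n j)"
    unfolding sum.atMost_Suc_shift sum_subtractf sum_distrib_left distrib_left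
    by (simp only: add_diff_eq)
  finally show ?case using ge2 by simp
qed simp_all

lemma lucas_U_odd_eq_sum_binomial:
  fixes P Q :: "'a::comm_ring_1"
  shows "lucas_U (2 * n + 1) P Q =
    (\<Sum>k\<le>n. of_nat ((n + k) choose (2 * k)) * P ^ (2 * k) * (- Q) ^ (n - k))"
proof -
  let ?t = "\<lambda>j. of_nat ((2 * n - j) choose j) * P ^ (2 * n - 2 * j) * (- Q) ^ j"
  have "lucas_U (2 * n + 1) P Q = sum ?t {..2 * n}"
    using lucas_U_Suc_eq_sum_binomial[of "2 * n"] by simp
  also have "\<dots> = sum ?t {..n}"
  proof (rule sum.mono_neutral_right)
    show "\<forall>j\<in>{..2 * n} - {..n}. ?t j = 0"
    proof
      fix j assume "j \<in> {..2 * n} - {..n}"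
      then have "2 * n - j < j" by auto
      then show "?t j = 0" by (simp add: binomial_eq_0)
    qed
  qed auto
  also have "\<dots> = (\<Sum>k\<le>n. ?t (n - k))"
    by (rule sum.reindex_bij_witness[where i = "\<lambda>k. n - k" and j = "\<lambda>k. n - k"]) auto
  also have "\<dots> = (\<Sum>k\<le>n. of_nat ((n + k) choose (2 * k)) * P ^ (2 * k) * (- Q) ^ (n - k))"
  proof (intro sum.cong refl)
    fix k assume "k \<in> {..n}"
    then have "k \<le> n" by simp
    then have "2 * n - (n - k) = n + k" "2 * n - 2 * (n - k) = 2 * k" "n + k - (n - k) = 2 * k"
      by simp_all
    moreover from \<open>k \<le> n\<close> have "(n + k) choose (n - k) = (n + k) choose (2 * k)"
      using binomial_symmetric[of "n - k" "n + k"] \<open>n + k - (n - k) = 2 * k\<close> by simp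
    ultimately show "?t (n - k) = of_nat ((n + k) choose (2 * k)) * P ^ (2 * k) * (- Q) ^ (n - k)"
      by (simp only:)
  qed
  finally show ?thesis .
qed

definition binomial_transform :: "'a::comm_ring_1 \<Rightarrow> (nat \<Rightarrow> 'a) \<Rightarrow> nat \<Rightarrow> 'a" where
  "binomial_transform x f n = (\<Sum>k\<le>n. of_nat (n choose k) * x ^ (n - k) * f k)"

lemma binomial_transform_0 [simp]: "binomial_transform x f 0 = f 0"
  by (simp add: binomial_transform_def)

lemma binomial_transform_Suc:
  "binomial_transform x f (Suc n) =
    x * binomial_transform x f n + binomial_transform x (\<lambda>k. f (Suc k)) n"
proof -
  let ?t = "\<lambda>k. of_nat (n choose k) * x ^ (Suc n - k) * f k"
  have "binomial_transform x f (Suc n) =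
      ?t 0 + (\<Sum>k\<le>n. ?t (Suc k)) + binomial_transform x (\<lambda>k. f (Suc k)) n"
    unfolding binomial_transform_def
    by (subst sum.atMost_Suc_shift) (simp add: algebra_simps sum.distrib)
  also have "?t 0 + (\<Sum>k\<le>n. ?t (Suc k)) = (\<Sum>k\<le>n. ?t k)"
    by (subst sum.atMost_Suc_shift[symmetric]) (simp add: binomial_eq_0)
  also have "\<dots> = x * binomial_transform x f n"
    unfolding binomial_transform_def sum_distrib_left
    by (intro sum.cong) (auto simp: Suc_diff_le algebra_simps)
  finally show ?thesis .
qed

lemma binomial_transform_lincomb:
  "binomial_transform x (\<lambda>k. c * f k - d * g k) n =
    c * binomial_transform x f n - d * binomial_transform x g n"
  by (simp add: binomial_transform_def sum_distrib_left sum_subtractf algebra_simps)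

text \<open>The transform adds \<open>x\<close> to both roots of \<open>X\<^sup>2 - P X + Q\<close>.\<close>

lemma binomial_transform_lucas_U:
  fixes P Q x :: "'a::comm_ring_1"
  defines "P' \<equiv> P + 2 * x" and "Q' \<equiv> Q + P * x + x\<^sup>2"
  shows "binomial_transform x (\<lambda>k. lucas_U k P Q) n = lucas_U n P' Q'"
    and "binomial_transform x (\<lambda>k. lucas_U (Suc k) P Q) n =
      lucas_U (Suc n) P' Q' - x * lucas_U n P' Q'"
proof (induction n)
  case (Suc n)
  let ?T = "binomial_transform x (\<lambda>k. lucas_U k P Q)"
  let ?S = "binomial_transform x (\<lambda>k. lucas_U (Suc k) P Q)"
  have transform_Suc: "?T (Suc n) = x * ?T n + ?S n"
    by (rule binomial_transform_Suc)
  have shifted_transform_Suc: "?S (Suc n) = x * ?S n + (P * ?S n - Q * ?T n)"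
    by (simp add: binomial_transform_Suc binomial_transform_lincomb)
  case 1 show ?case unfolding transform_Suc Suc.IH by simp
  case 2 show ?case
    unfolding shifted_transform_Suc Suc.IH by (simp add: P'_def Q'_def algebra_simps power2_eq_square)
qed simp_all

section \<open>Lucas sequences modulo a prime\<close>

lemma fermat_int:
  assumes "prime p" "p > 2"
  shows "[x ^ p = x] (mod int p)"
proof (cases "[x = 0] (mod int p)")
  case True
  then have "[x ^ p = 0 ^ p] (mod int p)" by (rule cong_pow)
  also have "(0 :: int) ^ p = 0" using assms(2) by (intro zero_power) simp
  finally show ?thesis using True cong_sym cong_trans by blast
next
  case False
  have "x ^ p = x * (x ^ ((p - 1) div 2))\<^sup>2"
    using assms prime_odd_nat[of p] by (auto elim!: oddE simp flip: power_mult power_Suc)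
  also have "[\<dots> = x * (Legendre x (int p))\<^sup>2] (mod int p)"
    using euler_criterion[OF assms, of x] by (intro cong_mult cong_pow) (auto simp: cong_sym)
  also have "(Legendre x (int p))\<^sup>2 = 1" using False by (simp add: Legendre_def)
  finally show ?thesis by simp
qed

lemma binomial_transform_prime_cong:
  assumes "prime p"
  shows "[binomial_transform x f p = x ^ p * f 0 + f p] (mod int p)"
proof -
  let ?t = "\<lambda>k. int (p choose k) * x ^ (p - k) * f k"
  have "p > 0" using assms prime_gt_0_nat by blast
  then have "{..p} = insert 0 (insert p {0<..<p})" by auto
  with \<open>p > 0\<close> have "binomial_transform x f p = x ^ p * f 0 + f p + sum ?t {0<..<p}"
    by (simp add: binomial_transform_def)
  moreover have "[sum ?t {0<..<p} = 0] (mod int p)"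
    unfolding cong_0_iff using assms by (intro dvd_sum dvd_mult2) (simp add: dvd_choose_prime)
  then have "[x ^ p * f 0 + f p + sum ?t {0<..<p} = x ^ p * f 0 + f p + 0] (mod int p)"
    by (intro cong_add cong_refl)
  ultimately show ?thesis by simp
qed

lemma lucas_U_prime_shift_cong:
  fixes P Q x :: int
  assumes "prime p" "p > 2"
  defines "P' \<equiv> P + 2 * x" and "Q' \<equiv> Q + P * x + x\<^sup>2"
  shows "[lucas_U p P' Q' = lucas_U p P Q] (mod int p)"
    and "[lucas_U (Suc p) P' Q' = lucas_U (Suc p) P Q + x * (1 + lucas_U p P Q)] (mod int p)"
proof -
  show U_p: "[lucas_U p P' Q' = lucas_U p P Q] (mod int p)"
    using binomial_transform_prime_cong[OF assms(1), of x "\<lambda>k. lucas_U k P Q"]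
    by (simp add: binomial_transform_lucas_U P'_def Q'_def)
  have "[lucas_U (Suc p) P' Q' - x * lucas_U p P' Q' = x ^ p + lucas_U (Suc p) P Q] (mod int p)"
    using binomial_transform_prime_cong[OF assms(1), of x "\<lambda>k. lucas_U (Suc k) P Q"]
    by (simp only: binomial_transform_lucas_U P'_def Q'_def lucas_U.simps mult_1_right)
  then have "[lucas_U (Suc p) P' Q' - x * lucas_U p P' Q' + x * lucas_U p P' Q' =
      x ^ p + lucas_U (Suc p) P Q + x * lucas_U p P Q] (mod int p)"
    using U_p by (intro cong_add cong_mult cong_refl)
  also have "[x ^ p + lucas_U (Suc p) P Q + x * lucas_U p P Q =
      x + lucas_U (Suc p) P Q + x * lucas_U p P Q] (mod int p)"
    using fermat_int[OF assms(1,2)] by (intro cong_add cong_refl)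
  finally show "[lucas_U (Suc p) P' Q' = lucas_U (Suc p) P Q + x * (1 + lucas_U p P Q)] (mod int p)"
    by (simp add: algebra_simps)
qed

lemma lucas_U_double_prime_cong_Legendre:
  fixes P Q :: int
  assumes "prime p" "p > 2"
  defines "\<epsilon> \<equiv> Legendre (P\<^sup>2 - 4 * Q) (int p)"
  shows "[lucas_U p (2 * P) (4 * Q) = \<epsilon>] (mod int p)"
    and "[lucas_U (Suc p) (2 * P) (4 * Q) = P * (1 + \<epsilon>)] (mod int p)"
proof -
  define D where "D = P\<^sup>2 - 4 * Q"
  have "odd p" using assms prime_odd_nat by blast
  then have "lucas_U p 0 (- D) = D ^ ((p - 1) div 2)" and "lucas_U (Suc p) 0 (- D) = 0"
    by (auto elim!: oddE simp: lucas_U_0_left)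
  then have shift: "[lucas_U p (2 * P) (4 * Q) = lucas_U p 0 (- D)] (mod int p)"
    "[lucas_U (Suc p) (2 * P) (4 * Q) = P * (1 + lucas_U p 0 (- D))] (mod int p)"
    and Legendre: "[lucas_U p 0 (- D) = \<epsilon>] (mod int p)"
    using lucas_U_prime_shift_cong[OF assms(1,2), of 0 P "- D"]
      euler_criterion[OF assms(1,2), of D]
    by (simp_all add: D_def \<epsilon>_def cong_sym)
  show "[lucas_U p (2 * P) (4 * Q) = \<epsilon>] (mod int p)"
    using shift(1) Legendre by (rule cong_trans)
  note shift(2)
  also have "[P * (1 + lucas_U p 0 (- D)) = P * (1 + \<epsilon>)] (mod int p)"
    using Legendre by (intro cong_mult cong_add cong_refl)
  finally show "[lucas_U (Suc p) (2 * P) (4 * Q) = P * (1 + \<epsilon>)] (mod int p)" .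
qed

lemma lucas_U_prime_cong_Legendre:
  fixes P Q :: int
  assumes "prime p" "p > 2"
  defines "\<epsilon> \<equiv> Legendre (P\<^sup>2 - 4 * Q) (int p)"
  shows "[lucas_U p P Q = \<epsilon>] (mod int p)"
    and "[2 * lucas_U (Suc p) P Q = P * (1 + \<epsilon>)] (mod int p)"
proof -
  note double = lucas_U_double_prime_cong_Legendre[OF assms(1,2), of P Q, folded \<epsilon>_def]
  have fermat_2: "[2 = 2 ^ p] (mod int p)"
    using fermat_int[OF assms(1,2)] by (rule cong_sym)
  obtain q where "p = Suc q" using assms(2) by (cases p) auto
  have "[2 * lucas_U p P Q = 2 ^ p * lucas_U p P Q] (mod int p)"
    using fermat_2 by (rule cong_scalar_right)
  also have "2 ^ p * lucas_U p P Q = 2 * lucas_U p (2 * P) (4 * Q)"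
    using lucas_U_scale[of q 2 P Q] by (simp add: \<open>p = Suc q\<close>)
  finally have "[lucas_U p P Q = lucas_U p (2 * P) (4 * Q)] (mod int p)"
    using assms(1,2) prime_odd_nat[of p] by (simp add: cong_mult_lcancel)
  then show "[lucas_U p P Q = \<epsilon>] (mod int p)" using double(1) by (rule cong_trans)
  have "[2 * lucas_U (Suc p) P Q = 2 ^ p * lucas_U (Suc p) P Q] (mod int p)"
    using fermat_2 by (rule cong_scalar_right)
  also have "2 ^ p * lucas_U (Suc p) P Q = lucas_U (Suc p) (2 * P) (4 * Q)"
    using lucas_U_scale[of p 2 P Q] by simp
  also note double(2)
  finally show "[2 * lucas_U (Suc p) P Q = P * (1 + \<epsilon>)] (mod int p)" .
qed

lemma lucas_U_reflect_cong:
  fixes P Q q :: int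
  assumes "[lucas_U N P Q = 0] (mod q)" "m \<le> N"
  shows "[lucas_U (Suc N) P Q * lucas_U m P Q = - (Q ^ m) * lucas_U (N - m) P Q] (mod q)"
proof -
  have "- (Q ^ m) * lucas_U (N - m) P Q =
      lucas_U (Suc N) P Q * lucas_U m P Q - lucas_U N P Q * lucas_U (Suc m) P Q"
    using lucas_U_d_Ocagne[of Q m "N - m" P] assms(2) by simp
  also have "[\<dots> = lucas_U (Suc N) P Q * lucas_U m P Q - 0 * lucas_U (Suc m) P Q] (mod q)"
    using assms(1) by (intro cong_diff cong_mult cong_refl)
  finally show ?thesis by (simp add: cong_sym)
qed

lemma coprime_prime_int: "prime p \<Longrightarrow> \<not> int p dvd c \<Longrightarrow> coprime c (int p)"
  by (metis coprime_commute prime_imp_coprime prime_nat_int_transfer)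

lemma lucas_U_reflect_Legendre_1:
  assumes "prime p" "p > 2" "\<not> int p dvd Q" "Legendre (P\<^sup>2 - 4 * Q) (int p) = 1" "m < p"
  shows "[lucas_U m P Q = - (Q ^ m) * lucas_U (p - 1 - m) P Q] (mod int p)"
proof -
  obtain q where q: "p = Suc q" using assms(2) by (cases p) auto
  have "coprime 2 (int p)" using assms(1,2) prime_odd_nat by auto
  have "coprime Q (int p)"
    using assms(1,3) by (rule coprime_prime_int)
  have U_p: "[lucas_U p P Q = 1] (mod int p)"
    and "[2 * lucas_U (Suc p) P Q = 2 * P] (mod int p)"
    using lucas_U_prime_cong_Legendre[OF assms(1,2), of P Q] assms(4) by (simp_all add: mult.commute)
  then have "[lucas_U (Suc p) P Q = P] (mod int p)"
    using \<open>coprime 2 (int p)\<close> cong_mult_lcancel by blast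
  then have "[P * lucas_U p P Q - lucas_U (Suc p) P Q = P * 1 - P] (mod int p)"
    using U_p by (intro cong_diff cong_mult cong_refl)
  then have "[Q * lucas_U q P Q = Q * 0] (mod int p)" by (simp add: q)
  then have "[lucas_U q P Q = 0] (mod int p)"
    using \<open>coprime Q (int p)\<close> cong_mult_lcancel by blast
  then have "[lucas_U p P Q * lucas_U m P Q = - (Q ^ m) * lucas_U (p - 1 - m) P Q] (mod int p)"
    using lucas_U_reflect_cong[of q P Q "int p" m] assms(5) by (simp add: q)
  moreover have "[1 * lucas_U m P Q = lucas_U p P Q * lucas_U m P Q] (mod int p)"
    using cong_sym[OF U_p] by (rule cong_scalar_right)
  ultimately show ?thesis by (metis cong_trans mult_1)
qed

lemma lucas_U_reflect_Legendre_neg_1: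
  assumes "prime p" "p > 2" "\<not> int p dvd Q" "Legendre (P\<^sup>2 - 4 * Q) (int p) = - 1" "m \<le> p"
  shows "[lucas_U (Suc m) P Q = - (Q ^ m) * lucas_U (p - m) P Q] (mod int p)"
proof -
  have "coprime 2 (int p)" using assms(1,2) prime_odd_nat by auto
  have "coprime Q (int p)"
    using assms(1,3) by (rule coprime_prime_int)
  have U_p: "[lucas_U p P Q = - 1] (mod int p)"
    and "[2 * lucas_U (Suc p) P Q = 2 * 0] (mod int p)"
    using lucas_U_prime_cong_Legendre[OF assms(1,2), of P Q] assms(4) by simp_all
  then have U_Suc_p: "[lucas_U (Suc p) P Q = 0] (mod int p)"
    using \<open>coprime 2 (int p)\<close> cong_mult_lcancel by blast
  have "[P * lucas_U (Suc p) P Q - Q * lucas_U p P Q = P * 0 - Q * (- 1)] (mod int p)"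
    using U_p U_Suc_p by (intro cong_diff cong_mult cong_refl)
  then have "[Q * lucas_U (Suc m) P Q = lucas_U (Suc (Suc p)) P Q * lucas_U (Suc m) P Q] (mod int p)"
    by (intro cong_mult cong_refl) (simp add: cong_sym)
  also have "[lucas_U (Suc (Suc p)) P Q * lucas_U (Suc m) P Q =
      Q * (- (Q ^ m) * lucas_U (p - m) P Q)] (mod int p)"
    using lucas_U_reflect_cong[OF U_Suc_p, of "Suc m"] assms(5)
    by (simp add: mult.assoc del: lucas_U.simps)
  finally show ?thesis
    using \<open>coprime Q (int p)\<close> cong_mult_lcancel by blast
qed

section \<open>The truncated sum of \<open>(3k choose k) x\<^sup>k\<close>\<close>

lemma fact_3_mult_eq_prod:
  "fact (3 * k) = fact k * (\<Prod>i<k. 3 * (3 * i + 1) * (3 * i + 2) :: nat)"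
proof (induction k)
  case (Suc k)
  have "fact (3 * Suc k) = (3 * k + 3) * (3 * k + 2) * (3 * k + 1) * (fact (3 * k) :: nat)"
    by (simp add: eval_nat_numeral algebra_simps)
  with Suc.IH show ?case
    by (simp only: prod.lessThan_Suc fact_Suc of_nat_id Suc_eq_plus1) (simp add: algebra_simps)
qed simp

lemma fact_mult_binomial_3:
  "fact (2 * k) * (3 * k choose k) = (\<Prod>i<k. 3 * (3 * i + 1) * (3 * i + 2))"
  using binomial_fact_lemma[of k "3 * k"] by (simp add: fact_3_mult_eq_prod)

lemma fact_add_eq_prod:
  "k \<le> n \<Longrightarrow> fact (n + k) = fact (n - k) * (\<Prod>i<k. (n + i + 1) * (n - i) :: nat)"
proof (induction k)
  case (Suc k)
  then have "fact (n - k) = (n - k) * (fact (n - Suc k) :: nat)"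
    by (simp add: fact_reduce)
  have "fact (n + Suc k) = (n + k + 1) * (fact (n + k) :: nat)" by simp
  also have "fact (n + k) = (n - k) * fact (n - Suc k) * (\<Prod>i<k. (n + i + 1) * (n - i))"
    using Suc by (simp only: Suc_leD \<open>fact (n - k) = _\<close>)
  finally show ?case by (simp only: prod.lessThan_Suc mult_ac)
qed simp

lemma fact_mult_binomial_add:
  "k \<le> n \<Longrightarrow> fact (2 * k) * ((n + k) choose (2 * k)) = (\<Prod>i<k. (n + i + 1) * (n - i))"
  using binomial_fact_lemma[of "2 * k" "n + k"] by (simp add: fact_add_eq_prod)

lemma binomial_3_cong:
  assumes "prime p" "p dvd (3 * n + 1) * (3 * n + 2)" "k \<le> n" "2 * k < p"
  shows "[int (3 * k choose k) = int ((n + k) choose (2 * k)) * (- 27) ^ k] (mod int p)"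
proof -
  have factor_cong:
    "[int (3 * (3 * i + 1) * (3 * i + 2)) = int ((n + i + 1) * (n - i)) * (- 27)] (mod int p)"
    if "i < k" for i
  proof -
    have "int (3 * (3 * i + 1) * (3 * i + 2)) - int ((n + i + 1) * (n - i)) * (- 27) =
        3 * int ((3 * n + 1) * (3 * n + 2))"
      using that assms(3) by (simp add: of_nat_diff ring_distribs)
    then show ?thesis
      using assms(2) by (simp only: cong_iff_dvd_diff) (simp only: dvd_mult int_dvd_int_iff)
  qed
  have "fact (2 * k) * int (3 * k choose k) = (\<Prod>i<k. int (3 * (3 * i + 1) * (3 * i + 2)))"
    using arg_cong[OF fact_mult_binomial_3, of int] by simp
  also have "[(\<Prod>i<k. int (3 * (3 * i + 1) * (3 * i + 2))) =
      (\<Prod>i<k. int ((n + i + 1) * (n - i)) * (- 27))] (mod int p)"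
    using factor_cong by (intro cong_prod) simp
  also have "(\<Prod>i<k. int ((n + i + 1) * (n - i)) * (- 27)) =
      int (\<Prod>i<k. (n + i + 1) * (n - i)) * (- 27) ^ k"
    by (simp only: prod.distrib[of _ "\<lambda>_. - 27"] prod_constant card_lessThan of_nat_prod)
  also have "int (\<Prod>i<k. (n + i + 1) * (n - i)) =
      fact (2 * k) * int ((n + k) choose (2 * k))"
    using arg_cong[OF fact_mult_binomial_add[OF assms(3)], of int] by simp
  finally have "[fact (2 * k) * int (3 * k choose k) =
      fact (2 * k) * (int ((n + k) choose (2 * k)) * (- 27) ^ k)] (mod int p)"
    by (simp only: mult.assoc)
  moreover have "\<not> int p dvd fact (2 * k)"
    using assms(1,4) prime_dvd_fact_iff by (metis int_dvd_int_iff not_le of_nat_fact)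
  then have "coprime (fact (2 * k)) (int p)"
    using assms(1) by (intro coprime_prime_int)
  ultimately show ?thesis using cong_mult_lcancel by blast
qed

definition triple_binomial_sum :: "nat \<Rightarrow> 'a::comm_ring_1 \<Rightarrow> 'a" where
  "triple_binomial_sum n x = (\<Sum>k = 0..n. of_nat (3 * k choose k) * x ^ k)"

lemma sum_binomial_3_divide_power:
  fixes a b :: "'a::field"
  shows "(\<Sum>k = 0..n. of_nat (3 * k choose k) * (b ^ (2 * k) / a ^ k)) =
    triple_binomial_sum n (b\<^sup>2 / a)"
  by (simp add: triple_binomial_sum_def power_divide power_mult)

lemma of_int_triple_binomial_sum:
  "of_int (triple_binomial_sum n x) = triple_binomial_sum n (of_int x)"
  by (simp add: triple_binomial_sum_def)

lemma triple_binomial_sum_cong_lucas_U: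
  assumes "prime p" "p dvd (3 * n + 1) * (3 * n + 2)" "2 * n < p" "[a * x = b\<^sup>2] (mod int p)"
  shows "[(- 3 * a) ^ n * triple_binomial_sum n x = lucas_U (2 * n + 1) (9 * b) (3 * a)] (mod int p)"
proof -
  have "[(- 3 * a) ^ n * (int (3 * k choose k) * x ^ k) =
      int ((n + k) choose (2 * k)) * (9 * b) ^ (2 * k) * (- (3 * a)) ^ (n - k)] (mod int p)"
    if "k \<le> n" for k
  proof -
    let ?C = "int ((n + k) choose (2 * k))" and ?R = "(- (3 * a)) ^ (n - k)"
    have "[(- 3 * a) ^ n * (int (3 * k choose k) * x ^ k) =
        (- 3 * a) ^ n * (?C * (- 27) ^ k * x ^ k)] (mod int p)"
      using that assms by (intro cong_mult cong_refl binomial_3_cong) auto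
    also have "(- 3 * a) ^ n * (?C * (- 27) ^ k * x ^ k) = ?C * (81 * (a * x)) ^ k * ?R"
    proof -
      have "(- 3 * a) ^ n = ?R * (- 3 * a) ^ k"
        using that by (simp flip: power_add)
      moreover have "(- 3 * a) ^ k * (- 27) ^ k * x ^ k = (81 * (a * x)) ^ k"
        unfolding power_mult_distrib[symmetric] by (simp add: mult.assoc)
      moreover have "?R * (- 3 * a) ^ k * (?C * (- 27) ^ k * x ^ k) =
          ?C * ((- 3 * a) ^ k * (- 27) ^ k * x ^ k) * ?R"
        by (simp only: mult_ac)
      ultimately show ?thesis by (simp only:)
    qed
    also have "[?C * (81 * (a * x)) ^ k * ?R = ?C * (81 * b\<^sup>2) ^ k * ?R] (mod int p)"
      using assms(4) by (intro cong_mult cong_pow cong_refl)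
    also have "(81 * b\<^sup>2) ^ k = (9 * b) ^ (2 * k)"
      by (simp add: power_mult power_mult_distrib)
    finally show ?thesis .
  qed
  then show ?thesis
    unfolding triple_binomial_sum_def lucas_U_odd_eq_sum_binomial sum_distrib_left atLeast0AtMost
    by (intro cong_sum) simp
qed

lemma prime_div_3_cases:
  assumes "prime (p :: nat)" "p > 3"
  shows "p = 3 * (p div 3) + 1 \<or> p = 3 * (p div 3) + 2"
proof -
  have "\<not> 3 dvd p" using assms by (auto simp: prime_nat_iff)
  then show ?thesis by presburger
qed

lemma Legendre_3_cong: "[Legendre a 3 = a] (mod 3)"
  using euler_criterion[of 3 a] by simp

lemma diff_Legendre_3_div_3:
  assumes "prime p" "p > 3"
  shows "(int p - Legendre (int p) 3) div 3 = int p - 2 * int (p div 3) - 1"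
proof -
  have "Legendre (int p) 3 \<in> {- 1, 0, 1}" by (simp add: Legendre_def)
  moreover have "Legendre (int p) 3 mod 3 = int p mod 3"
    using Legendre_3_cong unfolding cong_def .
  ultimately show ?thesis using prime_div_3_cases[OF assms] by auto presburger+
qed

lemma prime_not_dvd_3_mult:
  "prime p \<Longrightarrow> p > 3 \<Longrightarrow> \<not> int p dvd a \<Longrightarrow> \<not> int p dvd 3 * a"
  by (auto simp: prime_dvd_mult_iff dest: zdvd_imp_le)

lemma triple_binomial_sum_congI:
  assumes "prime p" "p > 3" "\<not> int p dvd a" "[a * x = b\<^sup>2] (mod int p)"
    and "[lucas_U (2 * (p div 3) + 1) (9 * b) (3 * a) = (- 3 * a) ^ (p div 3) * y] (mod int p)"
  shows "[triple_binomial_sum (p div 3) x = y] (mod int p)"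
proof -
  have "p dvd (3 * (p div 3) + 1) * (3 * (p div 3) + 2)"
    using prime_div_3_cases[OF assms(1,2)] by (metis dvd_triv_left dvd_triv_right)
  then have "[(- 3 * a) ^ (p div 3) * triple_binomial_sum (p div 3) x =
      lucas_U (2 * (p div 3) + 1) (9 * b) (3 * a)] (mod int p)"
    using assms by (intro triple_binomial_sum_cong_lucas_U) auto
  then have "[(- 3 * a) ^ (p div 3) * triple_binomial_sum (p div 3) x =
      (- 3 * a) ^ (p div 3) * y] (mod int p)"
    using assms(5) by (rule cong_trans)
  moreover have "coprime (- 3 * a) (int p)"
    using prime_not_dvd_3_mult[OF assms(1-3)] assms(1) by (intro coprime_prime_int) auto
  then have "coprime ((- 3 * a) ^ (p div 3)) (int p)"
    by (metis coprime_power_left_iff)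
  ultimately show ?thesis using cong_mult_lcancel by blast
qed

lemma triple_binomial_sum_cong_Legendre_1:
  assumes "prime p" "p > 3" "\<not> int p dvd a" "[a * x = b\<^sup>2] (mod int p)"
    and "Legendre (81 * b\<^sup>2 - 12 * a) (int p) = 1"
  shows "[triple_binomial_sum (p div 3) x = (- 3 * a) ^ (p div 3 + 1) *
    lucas_U (nat ((int p - Legendre (int p) 3) div 3 - 1)) (9 * b) (3 * a)] (mod int p)"
proof (rule triple_binomial_sum_congI[OF assms(1-4)])
  define n where "n = p div 3"
  have "Legendre ((9 * b)\<^sup>2 - 4 * (3 * a)) (int p) = 1"
    using assms(5) by (simp add: power_mult_distrib)
  moreover have "2 * n + 1 < p"
    using assms(2) by (simp add: n_def)
  ultimately have "[lucas_U (2 * n + 1) (9 * b) (3 * a) =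
      - ((3 * a) ^ (2 * n + 1)) * lucas_U (p - 1 - (2 * n + 1)) (9 * b) (3 * a)] (mod int p)"
    using assms(1,2) prime_not_dvd_3_mult[OF assms(1-3)]
    by (intro lucas_U_reflect_Legendre_1) auto
  also have "- ((3 * a) ^ (2 * n + 1)) = (- 3 * a) ^ n * (- 3 * a) ^ (n + 1)"
    unfolding power_add[symmetric] by (simp flip: mult_2)
  also have "p - 1 - (2 * n + 1) = nat ((int p - Legendre (int p) 3) div 3 - 1)"
    unfolding diff_Legendre_3_div_3[OF assms(1,2)] n_def by simp
  finally show "[lucas_U (2 * (p div 3) + 1) (9 * b) (3 * a) = (- 3 * a) ^ (p div 3) *
      ((- 3 * a) ^ (p div 3 + 1) *
        lucas_U (nat ((int p - Legendre (int p) 3) div 3 - 1)) (9 * b) (3 * a))] (mod int p)"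
    by (simp only: n_def mult.assoc)
qed

lemma triple_binomial_sum_cong_Legendre_neg_1:
  assumes "prime p" "p > 3" "\<not> int p dvd a" "[a * x = b\<^sup>2] (mod int p)"
    and "Legendre (81 * b\<^sup>2 - 12 * a) (int p) = - 1"
  shows "[triple_binomial_sum (p div 3) x = - ((- 3 * a) ^ (p div 3)) *
    lucas_U (nat ((int p - Legendre (int p) 3) div 3 + 1)) (9 * b) (3 * a)] (mod int p)"
proof (rule triple_binomial_sum_congI[OF assms(1-4)])
  define n where "n = p div 3"
  have "Legendre ((9 * b)\<^sup>2 - 4 * (3 * a)) (int p) = - 1"
    using assms(5) by (simp add: power_mult_distrib)
  then have "[lucas_U (Suc (2 * n)) (9 * b) (3 * a) =
      - ((3 * a) ^ (2 * n)) * lucas_U (p - 2 * n) (9 * b) (3 * a)] (mod int p)"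
    using assms(1,2) prime_not_dvd_3_mult[OF assms(1-3)]
    by (intro lucas_U_reflect_Legendre_neg_1) (auto simp: n_def)
  also have "- ((3 * a) ^ (2 * n)) = (- 3 * a) ^ n * - ((- 3 * a) ^ n)"
    by (simp only: mult_minus_right power_add[symmetric] mult_2[symmetric]) simp
  also have "p - 2 * n = nat ((int p - Legendre (int p) 3) div 3 + 1)"
    unfolding diff_Legendre_3_div_3[OF assms(1,2)] n_def by simp
  finally show "[lucas_U (2 * (p div 3) + 1) (9 * b) (3 * a) = (- 3 * a) ^ (p div 3) *
      (- ((- 3 * a) ^ (p div 3)) *
        lucas_U (nat ((int p - Legendre (int p) 3) div 3 + 1)) (9 * b) (3 * a))] (mod int p)"
    by (simp only: n_def mult.assoc Suc_eq_plus1)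
qed

section \<open>Congruences between \<open>p\<close>-integral rationals\<close>

context
  fixes p :: nat
  assumes prime_p: "prime p"
begin

lemma p_integers_of_int_divide:
  assumes "\<not> int p dvd d"
  shows "of_int c / of_int d \<in> p_integers p"
proof -
  obtain x y where xy: "quotient_of (of_int c / of_int d) = (x, y)" by fastforce
  then have "y > 0" "coprime x y" and "of_int c / of_int d = (of_int x / of_int y :: rat)"
    using quotient_of_denom_pos quotient_of_coprime quotient_of_div by blast+
  moreover have "d \<noteq> 0" using assms by auto
  ultimately have "(of_int (c * y) :: rat) = of_int (x * d)"
    by (simp add: field_simps)
  then have "y dvd x * d"
    by (simp only: of_int_eq_iff) (metis dvd_triv_right)
  then have "y dvd d" using \<open>coprime x y\<close>
    by (simp add: coprime_commute coprime_dvd_mult_right_iff)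
  then show ?thesis using assms xy by (auto simp: p_integers_def)
qed

lemma p_integersE:
  assumes "r \<in> p_integers p"
  obtains c d where "\<not> int p dvd d" "d \<noteq> 0" "r = of_int c / of_int d"
  using assms quotient_of_div[of r] quotient_of_denom_pos[of r]
  by (cases "quotient_of r") (force simp: p_integers_def)

lemma p_integers_of_int [simp]: "of_int c \<in> p_integers p"
  using p_integers_of_int_divide[of 1 c] prime_gt_1_nat[OF prime_p] by simp

lemma p_integers_of_nat [simp]: "of_nat c \<in> p_integers p"
  using p_integers_of_int[of "int c"] by simp

lemma p_integers_numeral [simp]: "numeral c \<in> p_integers p"
  using p_integers_of_int[of "numeral c"] by simp

lemma p_integers_0 [simp]: "0 \<in> p_integers p"
  using p_integers_of_int[of 0] by simp

lemma p_integers_1 [simp]: "1 \<in> p_integers p"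
  using p_integers_of_int[of 1] by simp

lemma p_integers_common_denominatorE:
  assumes "x \<in> p_integers p" "y \<in> p_integers p"
  obtains a b d where "\<not> int p dvd d" "d \<noteq> 0" "x = of_int a / of_int d" "y = of_int b / of_int d"
proof -
  from assms(1) obtain a c where x: "\<not> int p dvd c" "c \<noteq> 0" "x = of_int a / of_int c"
    by (rule p_integersE)
  from assms(2) obtain b d where y: "\<not> int p dvd d" "d \<noteq> 0" "y = of_int b / of_int d"
    by (rule p_integersE)
  show thesis
  proof (rule that)
    show "\<not> int p dvd c * d" using x y prime_p by (simp add: prime_dvd_mult_iff)
    show "x = of_int (a * d) / of_int (c * d)" "y = of_int (c * b) / of_int (c * d)"
      using x y by simp_all
  qed (use x y in simp)
qed

lemma p_integers_add:
  assumes "x \<in> p_integers p" "y \<in> p_integers p"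
  shows "x + y \<in> p_integers p"
proof -
  from assms obtain a b d
    where "\<not> int p dvd d" "d \<noteq> 0" "x = of_int a / of_int d" "y = of_int b / of_int d"
    by (rule p_integers_common_denominatorE)
  then show ?thesis
    using p_integers_of_int_divide[of d "a + b"] by (simp add: add_divide_distrib)
qed

lemma p_integers_mult:
  assumes "x \<in> p_integers p" "y \<in> p_integers p"
  shows "x * y \<in> p_integers p"
proof -
  from assms obtain a b d
    where "\<not> int p dvd d" "d \<noteq> 0" "x = of_int a / of_int d" "y = of_int b / of_int d"
    by (rule p_integers_common_denominatorE)
  then show ?thesis
    using p_integers_of_int_divide[of "d * d" "a * b"] prime_p by (simp add: prime_dvd_mult_iff)
qed

lemma p_integers_uminus: "x \<in> p_integers p \<Longrightarrow> - x \<in> p_integers p"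
  using p_integers_mult[of "of_int (- 1)" x] p_integers_of_int[of "- 1"] by simp

lemma p_integers_inverse:
  assumes "x \<in> p_integers p" "\<not> rat_cong p x 0"
  shows "inverse x \<in> p_integers p"
proof -
  from assms(1) obtain c d where x: "\<not> int p dvd d" "d \<noteq> 0" "x = of_int c / of_int d"
    by (rule p_integersE)
  have "\<not> int p dvd c"
  proof
    assume "int p dvd c"
    then obtain e where "c = int p * e" by blast
    then have "x - 0 = of_nat p * (of_int e / of_int d)" using x by simp
    then have "rat_cong p x 0"
      using assms(1) p_integers_0 p_integers_of_int_divide[OF x(1)] unfolding rat_cong_def by blast
    with assms(2) show False ..
  qed
  then show ?thesis using p_integers_of_int_divide[of c d] x by simp
qed

lemma rat_cong_refl: "x \<in> p_integers p \<Longrightarrow> rat_cong p x x"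
  unfolding rat_cong_def by (auto intro: bexI[of _ 0])

lemma rat_cong_sym: "rat_cong p x y \<Longrightarrow> rat_cong p y x"
  unfolding rat_cong_def by (metis minus_diff_eq mult_minus_right p_integers_uminus)

lemma rat_cong_add:
  assumes "rat_cong p x y" "rat_cong p x' y'"
  shows "rat_cong p (x + x') (y + y')"
proof -
  from assms obtain z z' where "z \<in> p_integers p" "x - y = of_nat p * z"
    "z' \<in> p_integers p" "x' - y' = of_nat p * z'"
    unfolding rat_cong_def by blast
  then have "z + z' \<in> p_integers p" "x + x' - (y + y') = of_nat p * (z + z')"
    by (auto intro: p_integers_add simp: algebra_simps)
  with assms show ?thesis
    unfolding rat_cong_def by (blast intro: p_integers_add)
qed

lemma rat_cong_mult:
  assumes "rat_cong p x y" "rat_cong p x' y'"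
  shows "rat_cong p (x * x') (y * y')"
proof -
  from assms obtain z z' where z: "z \<in> p_integers p" "x - y = of_nat p * z"
    "z' \<in> p_integers p" "x' - y' = of_nat p * z'"
    unfolding rat_cong_def by blast
  have "x * x' - y * y' = (x - y) * x' + y * (x' - y')"
    by (simp add: algebra_simps)
  also have "\<dots> = of_nat p * (z * x' + y * z')"
    unfolding z by (simp add: algebra_simps)
  finally show ?thesis
    using assms z unfolding rat_cong_def by (blast intro: p_integers_add p_integers_mult)
qed

lemma rat_cong_trans:
  assumes "rat_cong p x y" "rat_cong p y z"
  shows "rat_cong p x z"
  using rat_cong_add[OF assms] assms unfolding rat_cong_def by (simp add: algebra_simps)

lemma rat_cong_uminus: "rat_cong p x y \<Longrightarrow> rat_cong p (- x) (- y)"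
  using rat_cong_mult[of "- 1" "- 1" x y] rat_cong_refl[of "- 1"] p_integers_uminus[of 1] by simp

lemma rat_cong_diff: "rat_cong p x y \<Longrightarrow> rat_cong p x' y' \<Longrightarrow> rat_cong p (x - x') (y - y')"
  using rat_cong_add[of x y "- x'" "- y'"] rat_cong_uminus[of x' y'] by simp

lemma rat_cong_power: "rat_cong p x y \<Longrightarrow> rat_cong p (x ^ k) (y ^ k)"
  by (induction k) (auto intro: rat_cong_mult rat_cong_refl)

lemma rat_cong_sum:
  "(\<And>i. i \<in> I \<Longrightarrow> rat_cong p (f i) (g i)) \<Longrightarrow> rat_cong p (sum f I) (sum g I)"
  by (induction I rule: infinite_finite_induct) (auto intro: rat_cong_add rat_cong_refl)

lemma rat_cong_lucas_U:
  "rat_cong p P P' \<Longrightarrow> rat_cong p Q Q' \<Longrightarrow> rat_cong p (lucas_U n P Q) (lucas_U n P' Q')"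
  by (induction n rule: induct_nat_012) (auto intro: rat_cong_diff rat_cong_mult rat_cong_refl)

lemma rat_cong_triple_binomial_sum:
  "rat_cong p x y \<Longrightarrow> rat_cong p (triple_binomial_sum n x) (triple_binomial_sum n y)"
  unfolding triple_binomial_sum_def
  by (intro rat_cong_sum rat_cong_mult rat_cong_power rat_cong_refl) auto

lemma rat_cong_sum_binomial_3:
  assumes "rat_cong p (b\<^sup>2 / a) (of_int x)"
  shows "rat_cong p (\<Sum>k = 0..n. of_nat (3 * k choose k) * (b ^ (2 * k) / a ^ k))
    (of_int (triple_binomial_sum n x))"
  unfolding sum_binomial_3_divide_power of_int_triple_binomial_sum
  using assms by (rule rat_cong_triple_binomial_sum)

lemma rat_cong_of_int_iff: "rat_cong p (of_int c) (of_int d) \<longleftrightarrow> [c = d] (mod int p)"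
proof
  assume "rat_cong p (of_int c) (of_int d)"
  then obtain z where z: "z \<in> p_integers p" "of_int c - of_int d = of_nat p * z"
    unfolding rat_cong_def by blast
  from z(1) obtain x y where xy: "\<not> int p dvd y" "y \<noteq> 0" "z = of_int x / of_int y"
    by (rule p_integersE)
  have "(of_int ((c - d) * y) :: rat) = of_int (int p * x)"
    using z(2) xy by (simp add: field_simps)
  then have "int p dvd (c - d) * y"
    by (simp only: of_int_eq_iff) simp
  then show "[c = d] (mod int p)"
    using xy prime_p by (auto simp: prime_dvd_mult_iff cong_iff_dvd_diff)
next
  assume "[c = d] (mod int p)"
  then obtain k where "c - d = int p * k" by (auto simp: cong_iff_dvd_diff)
  then have "of_int c - of_int d = of_nat p * (of_int k :: rat)"
    by (metis of_int_diff of_int_mult of_int_of_nat_eq)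
  then show "rat_cong p (of_int c) (of_int d)"
    unfolding rat_cong_def by (auto intro: bexI[of _ "of_int k"])
qed

lemma rat_cong_iff_cong:
  assumes "rat_cong p x (of_int c)" "rat_cong p y (of_int d)"
  shows "rat_cong p x y \<longleftrightarrow> [c = d] (mod int p)"
  using assms rat_cong_of_int_iff rat_cong_sym rat_cong_trans by meson

lemma rat_cong_of_intE:
  assumes "r \<in> p_integers p"
  obtains c where "rat_cong p r (of_int c)"
proof -
  from assms obtain c d where r: "\<not> int p dvd d" "d \<noteq> 0" "r = of_int c / of_int d"
    by (rule p_integersE)
  obtain e where "[d * e = 1] (mod int p)"
    using cong_solve_coprime_int coprime_prime_int[OF prime_p r(1)] by blast
  then obtain k where "d * e - 1 = int p * k" by (auto simp: cong_iff_dvd_diff)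
  then have "(of_int (d * e - 1) :: rat) = of_int (int p * k)" by (simp only:)
  then have "r - of_int (c * e) = of_nat p * (of_int (- (c * k)) / of_int d)"
    using r by (simp add: field_simps)
  then have "rat_cong p r (of_int (c * e))"
    using assms p_integers_of_int p_integers_of_int_divide[OF r(1)] unfolding rat_cong_def by blast
  then show thesis by (rule that)
qed

lemma rat_Legendre_eq_Legendre:
  assumes "rat_cong p r (of_int c)"
  shows "rat_Legendre r p = Legendre c (int p)"
proof -
  have cong_iff: "rat_cong p r (of_int n) \<longleftrightarrow> [c = n] (mod int p)" for n
    using rat_cong_iff_cong[OF assms rat_cong_refl] by simp
  have "rat_residue p r = c mod int p"
    unfolding rat_residue_def cong_iff
    using prime_gt_0_nat[OF prime_p] by (intro the_equality) (auto simp: cong_def)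
  then show ?thesis
    by (simp add: rat_Legendre_def Legendre_def QuadRes_def cong_def)
qed

lemma rat_cong_divideE:
  assumes "a \<in> p_integers p" "\<not> rat_cong p a 0" "rat_cong p y (of_int e)"
  obtains c d where "\<not> int p dvd c" "rat_cong p a (of_int c)"
    "rat_cong p (y / a) (of_int d)" "[c * d = e] (mod int p)"
proof -
  obtain c where c: "rat_cong p a (of_int c)"
    using assms(1) by (rule rat_cong_of_intE)
  have "y / a \<in> p_integers p"
    using assms by (simp add: divide_inverse p_integers_mult p_integers_inverse rat_cong_def)
  then obtain d where d: "rat_cong p (y / a) (of_int d)"
    by (rule rat_cong_of_intE)
  have "a \<noteq> 0" using assms(2) rat_cong_refl by auto
  then have "rat_cong p y (of_int (c * d))"
    using rat_cong_mult[OF c d] by simp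
  then have "[c * d = e] (mod int p)"
    using rat_cong_iff_cong[OF _ assms(3)] rat_cong_refl assms(3) unfolding rat_cong_def by blast
  moreover have "\<not> int p dvd c"
    using assms(2) rat_cong_iff_cong[OF c, of 0 0] rat_cong_refl[of 0] by (simp add: cong_0_iff)
  ultimately show thesis using c d that by blast
qed

end

lemmas rat_cong_intros =
  rat_cong_refl rat_cong_uminus rat_cong_diff rat_cong_mult rat_cong_power rat_cong_lucas_U

theorem theorem3p3:
  fixes p :: nat and a b :: rat
  assumes "prime p" and "p > 3"
    and "a \<in> p_integers p" and "b \<in> p_integers p"
    and "\<not> rat_cong p (a * b) 0"
  shows "(rat_Legendre (81 * b^2 - 12 * a) p = 1 \<longrightarrow>
            rat_cong p
              (\<Sum>k = 0..p div 3. of_nat ((3 * k) choose k) * (b ^ (2 * k) / a ^ k))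
              ((- 3 * a) ^ (p div 3 + 1) *
                lucas_U (nat ((int p - Legendre (int p) 3) div 3 - 1)) (9 * b) (3 * a)))
       \<and> (rat_Legendre (81 * b^2 - 12 * a) p = - 1 \<longrightarrow>
            rat_cong p
              (\<Sum>k = 0..p div 3. of_nat ((3 * k) choose k) * (b ^ (2 * k) / a ^ k))
              (- ((- 3 * a) ^ (p div 3)) *
                lucas_U (nat ((int p - Legendre (int p) 3) div 3 + 1)) (9 * b) (3 * a)))"
proof -
  have "\<not> rat_cong p a 0"
    using rat_cong_mult[of p a 0 b b] rat_cong_refl[of p b] assms by auto
  obtain B where B: "rat_cong p b (of_int B)"
    using rat_cong_of_intE[OF assms(1,4)] .
  then have "rat_cong p (b\<^sup>2) (of_int (B\<^sup>2))"
    using rat_cong_power[OF assms(1)] by simp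
  then obtain A x where A: "\<not> int p dvd A" "rat_cong p a (of_int A)"
    and x: "rat_cong p (b\<^sup>2 / a) (of_int x)" "[A * x = B\<^sup>2] (mod int p)"
    using rat_cong_divideE[OF assms(1,3) \<open>\<not> rat_cong p a 0\<close>] by metis
  note lhs = rat_cong_sum_binomial_3[OF assms(1) x(1)]
  have rhs: "rat_cong p ((- 3 * a) ^ i * lucas_U m (9 * b) (3 * a))
      (of_int ((- 3 * A) ^ i * lucas_U m (9 * B) (3 * A)))"
    "rat_cong p (- ((- 3 * a) ^ i) * lucas_U m (9 * b) (3 * a))
      (of_int (- ((- 3 * A) ^ i) * lucas_U m (9 * B) (3 * A)))" for i m
    using A(2) B assms(1) by (auto simp: of_int_lucas_U intro!: rat_cong_intros)
  have Legendre: "rat_Legendre (81 * b\<^sup>2 - 12 * a) p = Legendre (81 * B\<^sup>2 - 12 * A) (int p)"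
    using A(2) B assms(1) by (intro rat_Legendre_eq_Legendre) (auto intro!: rat_cong_intros)
  show ?thesis
    unfolding Legendre rat_cong_iff_cong[OF assms(1) lhs rhs(1)]
      rat_cong_iff_cong[OF assms(1) lhs rhs(2)]
    using triple_binomial_sum_cong_Legendre_1[OF assms(1,2) A(1) x(2)]
      triple_binomial_sum_cong_Legendre_neg_1[OF assms(1,2) A(1) x(2)] by blast
qed

end
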